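(* For any positive integers $n$ and $k$, $$ f(n,k,0) \le \frac{n}{k} \left\lfloor \frac{k^2}{4} \right\rfloor + n + 1. $$
   Context: Let $[n]=\{1,\dots,n\}$. For non-negative integers $k,\lambda$, a family (set of distinct subsets) $\mathcal{F}\subset 2^{[n]}$ is called $k$-almost $\lambda$-Fisher if for every $F\in\mathcal{F}$ there are at most $k$ other sets $F'\in\mathcal{F}\setminus\{F\}$ with $|F\cap F'|\neq\lambda$. Define $f(n,k,\lambda)=\max\{|\mathcal{F}| : \mathcal{F}\subset 2^{[n]} \text{ is a } k\text{-almost } \lambda\text{-Fisher family}\}$. The empty set is allowed as a member of $\mathcal{F}$. *)

theory Defs
  imports Complex_Main
begin

definition almost_fisher :: "nat \<Rightarrow> nat \<Rightarrow> nat set set \<Rightarrow> bool" where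
  "almost_fisher k l \<F> \<longleftrightarrow>
     (\<forall>F\<in>\<F>. finite {F' \<in> \<F> - {F}. card (F \<inter> F') \<noteq> l} \<and>
             card {F' \<in> \<F> - {F}. card (F \<inter> F') \<noteq> l} \<le> k)"

definition max_almost_fisher :: "nat \<Rightarrow> nat \<Rightarrow> nat \<Rightarrow> nat" where
  "max_almost_fisher n k l = Max {card \<F> |\<F>. \<F> \<subseteq> Pow {1..n} \<and> almost_fisher k l \<F>}"

text \<open>The maximum is taken over a finite nonempty set.\<close>

lemma finite_card_almost_fisher:
  "finite {card \<F> |\<F>. \<F> \<subseteq> Pow {1..n} \<and> almost_fisher k l \<F>}"
proof -
  have "finite {\<F>. \<F> \<subseteq> Pow {1..n} \<and> almost_fisher k l \<F>}"
    by (rule finite_subset[of _ "Pow (Pow {1..n})"]) auto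
  then show ?thesis by simp
qed

lemma card_almost_fisher_nonempty:
  "{card \<F> |\<F>. \<F> \<subseteq> Pow {1..n} \<and> almost_fisher k l \<F>} \<noteq> {}"
proof -
  have "{} \<subseteq> Pow {1..n} \<and> almost_fisher k l {}"
    by (simp add: almost_fisher_def)
  then show ?thesis by blast
qed

end

theory Submission
  imports Defs
begin

text \<open>
  For \<open>\<lambda> = 0\<close> the condition says that every nonempty member of the family meets at most \<open>k\<close>
  other members. Write \<open>q = \<lfloor>k\<^sup>2/4\<rfloor>\<close>. The empty set accounts for the final \<open>+ 1\<close>, so let all members be
  nonempty.

  If a point \<open>x\<close> lies in a member \<open>D\<close> but \<open>{x}\<close> is not a member, then \<open>D\<close> may be exchanged for
  \<open>{x}\<close>: every set that meets \<open>{x}\<close> meets \<open>D\<close>. If \<open>x\<close> lies in no member, \<open>{x}\<close> may be added.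
  So all \<open>n\<close> singletons may be assumed to be members (\<open>exchange_for_singletons\<close>). Let \<open>G\<close> be the family
  of the other members. A set \<open>A\<close> in \<open>G\<close> meets \<open>|A|\<close> singletons, hence
  \<open>|A| + |{B \<in> G. A \<inter> B \<noteq> {}}| \<le> k + 1\<close>, and it remains to show \<open>k |G| \<le> q n\<close>.

  By induction on the ground set: if the number of members of \<open>G\<close> that meet \<open>A\<close> is at most
  \<open>(q/k) |A|\<close>, then the points of \<open>A\<close> can be deleted together with all these members
  (\<open>nonsingleton_bound\<close>). As \<open>k (k + 1 - |A|) \<le> q |A|\<close> when \<open>|A| \<ge> 4\<close>, and also when \<open>|A| = 3\<close> and
  \<open>k \<le> 8\<close>, there remain families of pairs and triples, with triples only for \<open>k \<ge> 9\<close>.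

  For these (\<open>pairs_and_triples_bound\<close>) give every pair weight \<open>1\<close> and every triple weight
  \<open>p = (k + 1) / (2k)\<close>, and let \<open>d x\<close> be the total weight of the sets through \<open>x\<close>. Then
  \<open>\<Sum>\<^sub>A \<Sum>\<^sub>x\<^sub>\<in>\<^sub>A w A / d x \<le> n\<close> by exchanging the sums, so it suffices that each \<open>A\<close> contributes at
  least \<open>k / q\<close>. For a pair \<open>{u, v}\<close> the contribution is \<open>1 / d u + 1 / d v\<close>; if only pairs meet
  it, then \<open>d u\<close> and \<open>d v\<close> are integers with sum at most \<open>k\<close>, so their product is at most \<open>q\<close>;
  if some triple meets it, then \<open>d u + d v \<le> k - 1/k\<close>, which makes up for the loss of
  integrality. For a triple the harmonic-arithmetic mean inequality leaves enough room as \<open>k \<ge> 9\<close>.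
\<close>

text \<open>The members of \<open>G\<close> that meet \<open>A\<close>; a nonempty member \<open>A\<close> of \<open>G\<close> is counted among them.\<close>

definition touching :: "'a set set \<Rightarrow> 'a set \<Rightarrow> 'a set set" where
  "touching G A = {B \<in> G. A \<inter> B \<noteq> {}}"

lemma touching_subset: "touching G A \<subseteq> G"
  by (auto simp: touching_def)

lemma finite_touching [simp]: "finite G \<Longrightarrow> finite (touching G A)"
  by (simp add: touching_def)

lemma touching_mono: "A \<subseteq> C \<Longrightarrow> touching G A \<subseteq> touching G C"
  by (auto simp: touching_def)

section \<open>Making all singletons members\<close>

text \<open>
  The singletons of the points of \<open>X\<close> are brought into the family one at a time, without making
  the family smaller or breaking the bound on the number of touching members.
\<close>

lemma exchange_for_singletons:
  assumes "finite V" "finite X" "X \<subseteq> V" "F \<subseteq> Pow V" "{} \<notin> F"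
    and "\<And>A. A \<in> F \<Longrightarrow> card (touching F A) \<le> k + 1"
  shows "\<exists>F'\<subseteq>Pow V. {} \<notin> F' \<and> (\<forall>A\<in>F'. card (touching F' A) \<le> k + 1)
           \<and> card F \<le> card F' \<and> (\<forall>x\<in>X. {x} \<in> F')"
  using assms(2,3)
proof (induction X rule: finite_induct)
  case empty
  show ?case using assms(4-6) by (intro exI[of _ F]) simp
next
  case (insert x X)
  then have "X \<subseteq> V" by simp
  from insert.IH[OF this] obtain H where "H \<subseteq> Pow V \<and> {} \<notin> H
      \<and> (\<forall>A\<in>H. card (touching H A) \<le> k + 1) \<and> card F \<le> card H \<and> (\<forall>x\<in>X. {x} \<in> H)"
    by (elim exE)
  then have H: "H \<subseteq> Pow V" "{} \<notin> H" "card F \<le> card H"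
      and H_touching: "\<And>A. A \<in> H \<Longrightarrow> card (touching H A) \<le> k + 1"
      and H_singleton: "\<And>x. x \<in> X \<Longrightarrow> {x} \<in> H"
    by simp_all
  have fin: "finite H" using H(1) assms(1) by (meson finite_Pow_iff finite_subset)
  show ?case
  proof (cases "{x} \<in> H")
    case True
    then show ?thesis using H H_touching H_singleton by (intro exI[of _ H]) simp
  next
    case new: False
    show ?thesis
    proof (cases "\<exists>D\<in>H. x \<in> D")
      case True
      then obtain D where D: "D \<in> H" "x \<in> D" by auto
      let ?H = "insert {x} (H - {D})"
      have "card (touching ?H A) \<le> k + 1" if A: "A \<in> ?H" for A
      proof (cases "x \<in> A")
        case True
        \<comment> \<open>The new set \<open>{x}\<close> is compared with the discarded \<open>D\<close>, every other set with itself;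
          the discarded \<open>D\<close> makes room for \<open>{x}\<close> in the count.\<close>
        let ?C = "if A = {x} then D else A"
        have C: "?C \<in> H" "D \<in> touching H ?C" "x \<in> ?C"
          using A D True by (auto simp: touching_def)
        have "touching ?H A \<subseteq> insert {x} (touching H ?C - {D})"
          using D True by (auto simp: touching_def)
        then have "card (touching ?H A) \<le> card (insert {x} (touching H ?C - {D}))"
          using fin by (intro card_mono) auto
        also have "\<dots> \<le> Suc (card (touching H ?C - {D}))"
          by (rule card_insert_le_m1) auto
        also have "\<dots> = card (touching H ?C)"
          using C(2) fin by (metis card.remove finite_touching card_Suc_Diff1)
        finally show ?thesis using H_touching[OF C(1)] by linarith
      next
        case False
        then have "A \<in> H" "touching ?H A \<subseteq> touching H A"
          using A by (auto simp: touching_def)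
        then show ?thesis using H_touching fin by (meson card_mono finite_touching order_trans)
      qed
      moreover have "card ?H = card H"
        using new fin card_Suc_Diff1[OF fin D(1)] by (simp del: card_Diff_singleton)
      moreover have "{y} \<in> ?H" if "y \<in> X" for y
        using H_singleton[OF that] new D by auto
      ultimately show ?thesis
        using H H_singleton insert.prems by (intro exI[of _ ?H]) auto
    next
      case False
      let ?H = "insert {x} H"
      have "touching ?H {x} = {{x}}" using False by (auto simp: touching_def)
      moreover have "touching ?H A = touching H A" if "A \<in> H" for A
        using False that by (auto simp: touching_def)
      ultimately have "\<forall>A\<in>?H. card (touching ?H A) \<le> k + 1" using H_touching by simp
      moreover have "card F \<le> card ?H" using H(3) new fin by simp
      ultimately show ?thesis
        using H H_singleton insert.prems by (intro exI[of _ ?H]) auto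
    qed
  qed
qed

section \<open>Weights on points\<close>

text \<open>
  If every member distributes at least \<open>t\<close> to its points, where a point \<open>x\<close> receives from each
  member through it that member's share of the total weight at \<open>x\<close>, then
  \<open>t |G| \<le> |V|\<close>, since a point receives in total \<open>1\<close> or nothing.
\<close>

lemma weighted_count:
  fixes w :: "'a set \<Rightarrow> real"
  assumes V: "finite V" "G \<subseteq> Pow V" and pos: "\<And>A. A \<in> G \<Longrightarrow> w A > 0"
    and ge: "\<And>A. A \<in> G \<Longrightarrow> t \<le> (\<Sum>x\<in>A. w A / (\<Sum>B | B \<in> G \<and> x \<in> B. w B))"
  shows "t * real (card G) \<le> real (card V)"
proof -
  have fin: "finite G" using V by (meson finite_Pow_iff finite_subset)
  let ?d = "\<lambda>x. \<Sum>B | B \<in> G \<and> x \<in> B. w B"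
  have "t * real (card G) = (\<Sum>A\<in>G. t)" by simp
  also have "\<dots> \<le> (\<Sum>A\<in>G. \<Sum>x\<in>A. w A / ?d x)" by (rule sum_mono) (rule ge)
  also have "\<dots> = (\<Sum>A\<in>G. \<Sum>x | x \<in> V \<and> x \<in> A. w A / ?d x)"
    using V(2) by (intro sum.cong) auto
  also have "\<dots> = (\<Sum>x\<in>V. \<Sum>A | A \<in> G \<and> x \<in> A. w A / ?d x)"
    by (rule sum.swap_restrict[OF fin V(1)])
  also have "\<dots> \<le> (\<Sum>x\<in>V. 1)"
    by (intro sum_mono) (simp add: sum_divide_distrib[symmetric])
  finally show ?thesis by simp
qed

lemma degree_sum:
  fixes w :: "'a set \<Rightarrow> real"
  assumes "finite G" "finite A"
  shows "(\<Sum>x\<in>A. \<Sum>B | B \<in> G \<and> x \<in> B. w B) = (\<Sum>B\<in>touching G A. w B * real (card (A \<inter> B)))"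
proof -
  have "(\<Sum>x\<in>A. \<Sum>B | B \<in> G \<and> x \<in> B. w B) = (\<Sum>B\<in>G. \<Sum>x | x \<in> A \<and> x \<in> B. w B)"
    using sum.swap_restrict[OF assms(2,1), of "\<lambda>x B. w B" "\<lambda>x B. x \<in> B"] by simp
  also have "\<dots> = (\<Sum>B\<in>G. w B * real (card (A \<inter> B)))"
    by (intro sum.cong) (auto simp: Int_def)
  also have "\<dots> = (\<Sum>B\<in>touching G A. w B * real (card (A \<inter> B)))"
    using assms by (intro sum.mono_neutral_right) (auto simp: touching_def)
  finally show ?thesis .
qed

lemma sum_le_distinguished:
  fixes f :: "'b \<Rightarrow> real"
  assumes "finite T" "a \<in> T" "\<And>b. b \<in> T - {a} \<Longrightarrow> f b \<le> m" "0 \<le> m" "real (card T) \<le> N"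
  shows "sum f T \<le> f a + m * (N - 1)"
proof -
  have "sum f T = f a + sum f (T - {a})" using assms by (simp add: sum.remove)
  also have "sum f (T - {a}) \<le> real (card (T - {a})) * m"
    using assms(3) by (intro sum_bounded_above) auto
  also have "real (card (T - {a})) = real (card T) - 1"
    using assms by (simp add: card_Diff_singleton of_nat_diff Suc_leI card_gt_0_iff)
      (metis Suc_leI card_gt_0_iff empty_iff of_nat_1 of_nat_diff One_nat_def)
  also have "(real (card T) - 1) * m \<le> m * (N - 1)"
    using assms(4,5) by (simp add: mult.commute mult_left_mono)
  finally show ?thesis by simp
qed

section \<open>Reciprocals and the quarter square\<close>

lemma four_quarter_square: "(real k)\<^sup>2 - 1 \<le> 4 * real (k\<^sup>2 div 4)"
proof -
  have "k\<^sup>2 mod 4 \<le> 1"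
  proof (cases "even k")
    case True
    then obtain m where "k = 2 * m" by auto
    then show ?thesis by (simp add: power_mult_distrib)
  next
    case False
    then obtain m where "k = 2 * m + 1" using oddE by blast
    then have "k\<^sup>2 = 4 * (m\<^sup>2 + m) + 1" by (simp add: power2_eq_square algebra_simps)
    then show ?thesis by presburger
  qed
  then have "k\<^sup>2 \<le> 4 * (k\<^sup>2 div 4) + 1" by presburger
  then have "real (k\<^sup>2) \<le> real (4 * (k\<^sup>2 div 4) + 1)" by (rule of_nat_mono)
  then show ?thesis by simp
qed

lemma quarter_square_pos:
  fixes k :: nat
  assumes "k \<ge> 2"
  shows "0 < k\<^sup>2 div 4"
proof -
  have "2\<^sup>2 \<le> k\<^sup>2" using assms by (intro power_mono) auto
  then show ?thesis by (simp add: div_greater_zero_iff)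
qed

text \<open>
  Real numbers \<open>a\<close> and \<open>b\<close> with sum \<open>k\<close> may have product \<open>k\<^sup>2/4\<close>, which exceeds its integer part
  for odd \<open>k\<close>. Lowering the sum by \<open>1/k\<close> compensates for this, because
  \<open>4 / (k - 1/k) = 4k / (k\<^sup>2 - 1)\<close>.
\<close>

lemma reciprocal_sum_ge:
  fixes a b :: real
  assumes k: "k \<ge> 2" and ab: "a > 0" "b > 0" and le: "a + b \<le> real k - 1 / real k"
  shows "real k / real (k\<^sup>2 div 4) \<le> 1 / a + 1 / b"
proof -
  let ?q = "real (k\<^sup>2 div 4)"
  have q: "?q > 0" using quarter_square_pos[OF k] by simp
  have "real k * (a + b) \<le> (real k)\<^sup>2 - 1"
    using mult_left_mono[OF le, of "real k"] k by (simp add: algebra_simps power2_eq_square)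
  then have "real k * (a + b) \<le> 4 * ?q" using four_quarter_square[of k] by linarith
  then have "real k * (a + b) * (a + b) \<le> 4 * ?q * (a + b)"
    using ab by (intro mult_right_mono) auto
  moreover have "real k * (4 * (a * b)) \<le> real k * ((a + b) * (a + b))"
    using sum_squares_ge_zero[of "a - b" 0]
    by (intro mult_left_mono) (auto simp: algebra_simps)
  ultimately have "real k * (a * b) \<le> ?q * (a + b)" by (simp add: algebra_simps)
  then show ?thesis using q ab by (simp add: field_simps)
qed

lemma reciprocal_sum_ge_nat:
  fixes a b :: nat
  assumes k: "k \<ge> 2" and ab: "a > 0" "b > 0" and le: "a + b \<le> k"
  shows "real k / real (k\<^sup>2 div 4) \<le> 1 / real a + 1 / real b"
proof (cases "a + b = k")
  case True
  have "real (4 * (a * b)) \<le> real ((a + b)\<^sup>2)"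
    using zero_le_power2[of "real a - real b"] by (simp add: power2_eq_square algebra_simps)
  then have "4 * (a * b) \<le> (a + b)\<^sup>2" by (rule of_nat_le_iff[THEN iffD1])
  then have "a * b \<le> k\<^sup>2 div 4" using True by simp
  then have "real (a * b) \<le> real (k\<^sup>2 div 4)" by (rule of_nat_mono)
  moreover have "real (a * b) > 0" using ab by simp
  ultimately have "real k / real (k\<^sup>2 div 4) \<le> real k / real (a * b)"
    by (intro divide_left_mono mult_pos_pos) auto
  also have "\<dots> = 1 / real a + 1 / real b" using ab True by (auto simp: field_simps)
  finally show ?thesis .
next
  case False
  then have "real a + real b \<le> real k - 1" using le by linarith
  moreover have "1 / real k \<le> 1" using k by simp
  ultimately have "real a + real b \<le> real k - 1 / real k" by linarith
  then show ?thesis using k ab by (intro reciprocal_sum_ge) auto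
qed

lemma reciprocal_sum3_ge:
  fixes a b c :: real
  assumes "a > 0" "b > 0" "c > 0"
  shows "9 / (a + b + c) \<le> 1 / a + 1 / b + 1 / c"
proof -
  have "(a + b + c) * (b * c + a * c + a * b) - 9 * (a * b * c)
      = a * (b - c)\<^sup>2 + b * (a - c)\<^sup>2 + c * (a - b)\<^sup>2"
    by (simp add: power2_eq_square algebra_simps)
  also have "\<dots> \<ge> 0" using assms by simp
  finally have "9 * (a * b * c) \<le> (a + b + c) * (b * c + a * c + a * b)" by simp
  moreover have "1 / a + 1 / b + 1 / c = (b * c + a * c + a * b) / (a * b * c)"
    using assms by (simp add: field_simps)
  ultimately show ?thesis using assms by (simp add: divide_le_eq le_divide_eq field_simps)
qed

section \<open>Families of pairs and triples\<close>

text \<open>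
  The weight \<open>p\<close> of a triple is slightly more than \<open>1/2\<close>. With \<open>1/2\<close> a set other than \<open>A\<close> would add
  at most \<open>1\<close> to the degree sum of a pair \<open>A\<close>, but the estimate for triples would fail for
  \<open>k = 9, 10, 11\<close>. The excess is affordable, since a pair contained in a triple \<open>C\<close> meets no more
  sets than \<open>C\<close> does, and hence at most \<open>k - 2\<close>, counting itself, instead of \<open>k - 1\<close>.
\<close>

lemma pairs_and_triples_bound:
  fixes G :: "'a set set"
  assumes V: "finite V" "G \<subseteq> Pow V" and k: "k \<ge> 2"
    and size: "\<And>A. A \<in> G \<Longrightarrow> card A = 2 \<or> card A = 3 \<and> 9 \<le> k"
    and touch: "\<And>A. A \<in> G \<Longrightarrow> card A + card (touching G A) \<le> k + 1"
  shows "k * card G \<le> k\<^sup>2 div 4 * card V"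
proof -
  have fin: "finite G" using V by (meson finite_Pow_iff finite_subset)
  define p where "p = (real k + 1) / (2 * real k)"
  define w where "w = (\<lambda>B::'a set. if card B = 2 then 1 else p)"
  define d where "d = (\<lambda>x. \<Sum>B | B \<in> G \<and> x \<in> B. w B)"
  let ?q = "real (k\<^sup>2 div 4)"
  have p: "1/2 \<le> p" "p \<le> 1" "p > 0" "2 * real k * p = real k + 1"
    using k by (auto simp: p_def field_simps)
  have w: "w B > 0" "w B \<le> 1" for B using p by (auto simp: w_def)
  have q: "?q > 0" using quarter_square_pos[OF k] by simp
  have finA: "finite A" if "A \<in> G" for A
    using that V by (meson PowD finite_subset subsetD)
  have d_pos: "d x > 0" if "A \<in> G" "x \<in> A" for A x
    unfolding d_def using that fin w by (intro sum_pos) auto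
  have deg: "sum d A = (\<Sum>B\<in>touching G A. w B * real (card (A \<inter> B)))" if "A \<in> G" for A
    unfolding d_def using degree_sum[OF fin finA[OF that]] .
  have self: "A \<in> touching G A" if "A \<in> G" for A
    using that size[OF that] by (auto simp: touching_def)
  \<comment> \<open>Apart from \<open>A\<close> and the pairs inside it, no set adds more than \<open>2p\<close> to the degree sum of \<open>A\<close>.\<close>
  have outside: "w B * real (card (A \<inter> B)) \<le> 2 * p"
    if "A \<in> G" "B \<in> G" "A \<noteq> B" "\<not> (card B = 2 \<and> B \<subseteq> A)" for A B
  proof (cases "card B = 2")
    case True
    have "A \<inter> B \<subset> B" using that True by auto
    then have "card (A \<inter> B) < 2" using finA[OF that(2)] True by (metis psubset_card_mono)
    then show ?thesis using True p by (simp add: w_def)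
  next
    case False
    then have B: "card B = 3" using size[OF that(2)] by auto
    have "\<not> B \<subseteq> A"
    proof
      assume "B \<subseteq> A"
      then have "B \<subset> A" using that by auto
      then have "card B < card A" using finA[OF that(1)] by (rule psubset_card_mono[rotated])
      then show False using B size[OF that(1)] by auto
    qed
    then have "A \<inter> B \<subset> B" by auto
    then have "card (A \<inter> B) < 3" using finA[OF that(2)] B by (metis psubset_card_mono)
    then have "real (card (A \<inter> B)) \<le> 2" by simp
    then show ?thesis using False p by (simp add: w_def mult.commute)
  qed
  have main: "real k / ?q \<le> (\<Sum>x\<in>A. w A / d x)" if A: "A \<in> G" for A
  proof (cases "card A = 2")
    case True
    then obtain u v where uv: "A = {u, v}" "u \<noteq> v" by (auto simp: card_2_iff)
    have dA: "sum d A = d u + d v" using uv by simp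
    have pos: "d u > 0" "d v > 0" using d_pos[OF A] uv by auto
    have sum_A: "(\<Sum>x\<in>A. w A / d x) = 1 / d u + 1 / d v"
      using uv True by (simp add: w_def)
    have self_term: "w A * real (card (A \<inter> A)) = 2" using True by (simp add: w_def)
    have N: "real (card (touching G A)) \<le> real k - 1"
      using touch[OF A] True by simp
    have not_inside: "\<not> (card B = 2 \<and> B \<subseteq> A)" if "B \<noteq> A" for B
      using that True finA[OF A] by (metis card_subset_eq)
    have le_1: "w B * real (card (A \<inter> B)) \<le> 1" if "B \<in> G" "\<not> A \<subseteq> B" for B
    proof -
      have "A \<inter> B \<subset> A" using that by auto
      then have "card (A \<inter> B) < 2" using finA[OF A] True by (metis psubset_card_mono)
      then have "real (card (A \<inter> B)) \<le> 1" by simp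
      then show ?thesis using w[of B] by (metis mult_le_one of_nat_0_le_iff)
    qed
    \<comment> \<open>A triple contains the pair; or no triple does, but one meets it; or no triple meets it.\<close>
    consider (above) C where "C \<in> G" "card C = 3" "A \<subseteq> C"
      | (meeting) C where "\<forall>B\<in>G. card B = 3 \<longrightarrow> \<not> A \<subseteq> B" "C \<in> touching G A" "card C = 3"
      | (pairs) "\<forall>B\<in>touching G A. card B \<noteq> 3"
      by (auto simp: touching_def)
    then show ?thesis
    proof cases
      case above
      have "card (touching G A) \<le> card (touching G C)"
        using above fin by (intro card_mono touching_mono) auto
      then have "real (card (touching G A)) \<le> real k - 2"
        using touch[OF above(1)] above(2) by simp
      moreover have "w B * real (card (A \<inter> B)) \<le> 2 * p" if "B \<in> touching G A - {A}" for B
        using that not_inside[of B] by (intro outside[OF A]) (auto simp: touching_def)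
      ultimately have "sum d A \<le> w A * real (card (A \<inter> A)) + 2 * p * ((real k - 2) - 1)"
        unfolding deg[OF A] using self[OF A] fin p by (intro sum_le_distinguished) auto
      also have "\<dots> = 2 + 2 * p * ((real k - 2) - 1)" unfolding self_term ..
      \<comment> \<open>As \<open>2p = (k + 1) / k\<close>, the left-hand side is \<open>k - 3/k\<close>.\<close>
      also have "\<dots> \<le> real k - 1 / real k"
        using k unfolding p_def by (simp add: field_simps)
      finally show ?thesis
        unfolding sum_A using dA pos k by (intro reciprocal_sum_ge) auto
    next
      case meeting
      have C: "C \<in> G" "C \<in> touching G A - {A}" "\<not> A \<subseteq> C" using meeting True by (auto simp: touching_def)
      have k9: "k \<ge> 9" using size[OF C(1)] meeting by auto
      let ?f = "\<lambda>B. w B * real (card (A \<inter> B))"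
      have fC: "?f C \<le> p"
      proof -
        have "A \<inter> C \<subset> A" using C by auto
        then have "card (A \<inter> C) < 2" using finA[OF A] True by (metis psubset_card_mono)
        then have "real (card (A \<inter> C)) \<le> 1" by simp
        then show ?thesis using p meeting(3) by (simp add: w_def)
      qed
      have bound: "?f B \<le> 1" if "B \<in> touching G A - {A}" for B
      proof (rule le_1)
        show "B \<in> G" using that by (auto simp: touching_def)
        show "\<not> A \<subseteq> B"
        proof
          assume "A \<subseteq> B"
          moreover have "card B = 2 \<or> card B = 3" "finite B"
            using that size finA by (auto simp: touching_def)
          ultimately show False
            using that meeting(1) \<open>B \<in> G\<close> True by (metis card_subset_eq DiffD2 singletonI)
        qed
      qed
      \<comment> \<open>\<open>A\<close> adds \<open>2\<close>, the triple \<open>C\<close> at most \<open>p\<close>, and the other \<open>k - 3\<close> sets at most \<open>1\<close> each.\<close>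
      have "sum d A = ?f A + sum ?f (touching G A - {A})"
        unfolding deg[OF A] using fin self[OF A] by (intro sum.remove) auto
      also have "sum ?f (touching G A - {A}) \<le> ?f C + 1 * ((real k - 2) - 1)"
      proof (rule sum_le_distinguished)
        have "Suc (card (touching G A - {A})) = card (touching G A)"
          using fin self[OF A] by (intro card_Suc_Diff1) auto
        then show "real (card (touching G A - {A})) \<le> real k - 2" using N by linarith
      qed (use fin C(2) bound in auto)
      finally have "sum d A \<le> 2 + p + (real k - 3)" using fC self_term by simp
      also have "\<dots> \<le> real k - 1 / real k"
        using k9 unfolding p_def by (simp add: field_simps)
      finally show ?thesis
        unfolding sum_A using dA pos k by (intro reciprocal_sum_ge) auto
    next
      case pairs
      have w1: "w B = 1" if "B \<in> G" "x \<in> B" "x \<in> A" for B x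
        using pairs size that by (auto simp: w_def touching_def)
      have d_nat: "d x = real (card {B \<in> G. x \<in> B})" if "x \<in> A" for x
      proof -
        have "d x = (\<Sum>B | B \<in> G \<and> x \<in> B. 1)"
          unfolding d_def using w1 that by (intro sum.cong) auto
        then show ?thesis by simp
      qed
      have "sum d A \<le> w A * real (card (A \<inter> A)) + 1 * ((real k - 1) - 1)"
        unfolding deg[OF A]
      proof (rule sum_le_distinguished)
        fix B assume B: "B \<in> touching G A - {A}"
        then have "card B = 2" using size pairs by (auto simp: touching_def)
        then have "\<not> A \<subseteq> B" using B True finA by (metis DiffD1 DiffD2 card_subset_eq
              singletonI subsetD touching_subset)
        then show "w B * real (card (A \<inter> B)) \<le> 1"
          using B by (intro le_1) (auto simp: touching_def)
      qed (use fin self[OF A] N in auto)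
      then have "d u + d v \<le> real k" unfolding self_term using dA by simp
      then show ?thesis
        unfolding sum_A using d_nat uv pos k
        by (simp only: insertI1 insertI2) (intro reciprocal_sum_ge_nat; simp flip: of_nat_add)
    qed
  next
    case False
    then have A3: "card A = 3" and k9: "k \<ge> 9" using size[OF A] by auto
    then obtain a b c where abc: "A = {a, b, c}" "a \<noteq> b" "a \<noteq> c" "b \<noteq> c"
      by (auto simp: card_3_iff)
    have pos: "d a > 0" "d b > 0" "d c > 0" using d_pos[OF A] abc by auto
    let ?f = "\<lambda>B. w B * real (card (A \<inter> B))"
    let ?P = "{B. B \<subseteq> A \<and> card B = 2}"
    let ?T = "touching G A"
    have finP: "finite ?P" using finA[OF A] by simp
    have "card ?P = 3" using n_subsets[OF finA[OF A], of 2] A3 by (simp add: choose_two)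
    then have "card (?T \<inter> ?P) \<le> 3" using card_mono[OF finP, of "?T \<inter> ?P"] by simp
    then have inside: "(2 - 2 * p) * real (card (?T \<inter> ?P)) \<le> (2 - 2 * p) * 3"
      using p by (intro mult_left_mono) auto
    have N: "real (card ?T) \<le> real k - 2"
      using touch[OF A] A3 by simp
    \<comment> \<open>Every set adds at most \<open>2p\<close>, except that \<open>A\<close> adds \<open>3p\<close> and each of the at most three pairs
      inside \<open>A\<close> adds \<open>2\<close>.\<close>
    have "sum d A = sum ?f ?T" by (rule deg[OF A])
    also have "\<dots> \<le> (\<Sum>B\<in>?T. 2 * p + (if B = A then p else 0) + (if B \<in> ?P then 2 - 2 * p else 0))"
    proof (rule sum_mono)
      fix B assume B: "B \<in> ?T"
      consider "B = A" | "B \<noteq> A" "B \<in> ?P" | "B \<noteq> A" "B \<notin> ?P" by blast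
      then show "?f B \<le> 2 * p + (if B = A then p else 0) + (if B \<in> ?P then 2 - 2 * p else 0)"
      proof cases
        case 1
        then show ?thesis using A3 by (simp add: w_def)
      next
        case 2
        then have "A \<inter> B = B" by auto
        then show ?thesis using 2 by (simp add: w_def)
      next
        case 3
        then have "?f B \<le> 2 * p" using B A by (intro outside) (auto simp: touching_def)
        then show ?thesis using 3 by (simp only: if_False)
      qed
    qed
    also have "\<dots> = 2 * p * real (card ?T) + p + (2 - 2 * p) * real (card (?T \<inter> ?P))"
    proof -
      have "(\<Sum>B\<in>?T. if B = A then p else 0) = p"
        using fin self[OF A] by simp
      moreover have "(\<Sum>B\<in>?T. if B \<in> ?P then 2 - 2 * p else 0) = (\<Sum>B\<in>?T \<inter> ?P. 2 - 2 * p)"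
        using fin by (intro sum.inter_restrict[symmetric]) simp
      ultimately show ?thesis by (simp add: sum.distrib mult.commute del: mem_Collect_eq)
    qed
    also have "\<dots> \<le> 2 * p * (real k - 2) + p + (2 - 2 * p) * 3"
    proof -
      have "2 * p * real (card ?T) \<le> 2 * p * (real k - 2)"
        using N p by (intro mult_left_mono) auto
      then show ?thesis using inside by linarith
    qed
    also have "\<dots> = real k + 7 - 9 * p" using p(4) by (simp add: algebra_simps)
    finally have S: "d a + d b + d c \<le> real k + 7 - 9 * p" using abc by (simp add: add.assoc)
    have "real k * (real k + 7 - 9 * p) \<le> 9 * p * ?q"
    proof -
      define Z where "Z = 9 * p * ((real k)\<^sup>2 - 1) - 4 * (real k * (real k + 7 - 9 * p))"
      \<comment> \<open>With \<open>2kp = k + 1\<close>, twice \<open>k Z\<close> becomes the polynomial \<open>k\<^sup>3 - 11k\<^sup>2 + 27k - 9\<close>, expanded here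
        around \<open>k = 9\<close>.\<close>
      have "0 \<le> (real k - 9) * ((real k - 1)\<^sup>2 + 8) + 72" using k9 by simp
      also have "\<dots> = 9 * (real k + 1) * ((real k)\<^sup>2 - 1)
          - (8 * (real k)^3 + 56 * (real k)\<^sup>2 - 36 * real k * (real k + 1))"
        by (simp add: power2_eq_square power3_eq_cube algebra_simps)
      also have "\<dots> = 2 * real k * Z"
        unfolding Z_def p(4)[symmetric] by (simp add: power2_eq_square power3_eq_cube algebra_simps)
      finally have "0 \<le> 2 * real k * Z" .
      then have "0 \<le> Z" using k by (simp add: zero_le_mult_iff)
      then have "4 * (real k * (real k + 7 - 9 * p)) \<le> 9 * p * ((real k)\<^sup>2 - 1)"
        unfolding Z_def by simp
      also have "\<dots> \<le> 9 * p * (4 * ?q)"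
        using four_quarter_square[of k] p by (intro mult_left_mono) auto
      finally show ?thesis by simp
    qed
    moreover have "real k * (d a + d b + d c) \<le> real k * (real k + 7 - 9 * p)"
      using S by (intro mult_left_mono) auto
    ultimately have "real k * (d a + d b + d c) \<le> 9 * p * ?q" by linarith
    moreover have D: "d a + d b + d c > 0" using pos by linarith
    ultimately have "real k / ?q \<le> 9 * p / (d a + d b + d c)"
      by (simp only: pos_divide_le_eq[OF q] times_divide_eq_left pos_le_divide_eq[OF D])
    also have "\<dots> = p * (9 / (d a + d b + d c))" by simp
    also have "\<dots> \<le> p * (1 / d a + 1 / d b + 1 / d c)"
      using p pos by (intro mult_left_mono reciprocal_sum3_ge) auto
    also have "\<dots> = (\<Sum>x\<in>A. w A / d x)"
      using abc A3 by (simp add: w_def field_simps)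
    finally show ?thesis .
  qed
  have "real k / ?q * real (card G) \<le> real (card V)"
    using weighted_count[OF V, of w "real k / ?q"] w(1) main unfolding d_def by blast
  then have "real (k * card G) \<le> real (k\<^sup>2 div 4 * card V)"
    using q by (simp add: field_simps)
  then show ?thesis by (rule of_nat_le_iff[THEN iffD1])
qed

section \<open>Deleting points\<close>

lemma nonsingleton_bound:
  fixes G :: "'a set set"
  assumes "finite V" "G \<subseteq> Pow V" and k: "k \<ge> 1"
    and "\<And>A. A \<in> G \<Longrightarrow> 2 \<le> card A"
    and "\<And>A. A \<in> G \<Longrightarrow> card A + card (touching G A) \<le> k + 1"
  shows "k * card G \<le> k\<^sup>2 div 4 * card V"
  using assms(1,2,4,5)
proof (induction V arbitrary: G rule: finite_psubset_induct)
  case (psubset V)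
  note V = psubset.hyps psubset.prems(1) and size = psubset.prems(2) and touch = psubset.prems(3)
  have fin: "finite G" using V by (meson finite_Pow_iff finite_subset)
  have finA: "finite A" if "A \<in> G" for A
    using that V by (meson PowD finite_subset subsetD)
  have self: "A \<in> touching G A" if "A \<in> G" for A
    using that size[OF that] by (auto simp: touching_def)
  show ?case
  \<comment> \<open>In the first case the set \<open>A\<close> can be deleted with all members that meet it.\<close>
  proof (cases "\<exists>A\<in>G. k * (k + 1 - card A) \<le> k\<^sup>2 div 4 * card A")
    case True
    then obtain A where A: "A \<in> G" "k * (k + 1 - card A) \<le> k\<^sup>2 div 4 * card A" by auto
    let ?G = "G - touching G A"
    have AV: "A \<subseteq> V" "A \<noteq> {}" using A V size[OF A(1)] by auto
    have "k * card ?G \<le> k\<^sup>2 div 4 * card (V - A)"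
    proof (rule psubset.IH)
      show "V - A \<subset> V" using AV by auto
      show "?G \<subseteq> Pow (V - A)" using V by (auto simp: touching_def)
      show "2 \<le> card B" if "B \<in> ?G" for B using that size by auto
      show "card B + card (touching ?G B) \<le> k + 1" if "B \<in> ?G" for B
      proof -
        have "card (touching ?G B) \<le> card (touching G B)"
          using fin by (intro card_mono) (auto simp: touching_def)
        moreover have "card B + card (touching G B) \<le> k + 1" using that touch by simp
        ultimately show ?thesis by linarith
      qed
    qed
    moreover have "k * card (touching G A) \<le> k\<^sup>2 div 4 * card A"
    proof -
      have "card (touching G A) \<le> k + 1 - card A" using touch[OF A(1)] by linarith
      then have "k * card (touching G A) \<le> k * (k + 1 - card A)" by (rule mult_le_mono2)
      then show ?thesis using A(2) by linarith
    qed
    moreover have "card G = card ?G + card (touching G A)"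
      using card_Diff_subset[OF finite_touching[OF fin] touching_subset, of A]
        card_mono[OF fin touching_subset, of A] by linarith
    moreover have "card V = card (V - A) + card A"
      using card_Diff_subset[OF finA[OF A(1)] AV(1)] card_mono[OF V(1) AV(1)] by linarith
    ultimately show ?thesis by (simp add: distrib_left)
  next
    case False
    show ?thesis
    proof (cases "G = {}")
      case True
      then show ?thesis by simp
    next
      case nonempty: False
      have pos: "card (touching G A) \<ge> 1" if "A \<in> G" for A
        using self[OF that] fin by (auto simp: Suc_le_eq card_gt_0_iff)
      have k2: "k \<ge> 2"
      proof -
        obtain A where "A \<in> G" using nonempty by auto
        then show ?thesis using touch[of A] size[of A] pos[of A] by linarith
      qed
      have "card A = 2 \<or> card A = 3 \<and> 9 \<le> k" if A: "A \<in> G" for A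
      proof (rule ccontr)
        assume *: "\<not> ?thesis"
        have "k * (k + 1 - card A) \<le> k\<^sup>2 div 4 * card A"
        proof (cases "card A = 3")
          case True
          then have "k = 2 \<or> k = 3 \<or> k = 4 \<or> k = 5 \<or> k = 6 \<or> k = 7 \<or> k = 8"
            using * k2 by linarith
          then show ?thesis using True by (elim disjE) simp_all
        next
          case False
          then have A4: "card A \<ge> 4" using * size[OF A] by linarith
          have "k\<^sup>2 mod 4 < 4" by simp
          then have *: "k\<^sup>2 \<le> 4 * (k\<^sup>2 div 4) + 3" by presburger
          have "k * (k + 1 - card A) \<le> k * (k - 2)" using A4 by (intro mult_le_mono2) linarith
          also have "\<dots> \<le> k\<^sup>2 div 4 * 4" using k2 * by (simp add: power2_eq_square diff_mult_distrib2)
          also have "\<dots> \<le> k\<^sup>2 div 4 * card A" using A4 by (intro mult_le_mono2)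
          finally show ?thesis .
        qed
        then show False using A \<open>\<not> (\<exists>A\<in>G. k * (k + 1 - card A) \<le> k\<^sup>2 div 4 * card A)\<close> by blast
      qed
      then show ?thesis using V k2 touch by (intro pairs_and_triples_bound) auto
    qed
  qed
qed

section \<open>The bound\<close>

lemma nonempty_family_bound:
  assumes V: "finite V" "F \<subseteq> Pow V" "{} \<notin> F" and k: "k \<ge> 1"
    and touch: "\<And>A. A \<in> F \<Longrightarrow> card (touching F A) \<le> k + 1"
  shows "k * card F \<le> (k\<^sup>2 div 4 + k) * card V"
proof -
  obtain H where H: "H \<subseteq> Pow V" "{} \<notin> H" "card F \<le> card H" "\<forall>x\<in>V. {x} \<in> H"
      and H_touching: "\<forall>A\<in>H. card (touching H A) \<le> k + 1"
    using exchange_for_singletons[OF V(1) V(1) order_refl V(2,3) touch] by auto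
  let ?S = "(\<lambda>x. {x}) ` V" and ?G = "H - (\<lambda>x. {x}) ` V"
  have fin: "finite H" using H(1) V(1) by (meson finite_Pow_iff finite_subset)
  have finA: "finite A" if "A \<in> H" for A
    using that H V by (meson PowD finite_subset subsetD)
  have card_S: "card ((\<lambda>x. {x}) ` A) = card A" for A :: "'a set"
    by (intro card_image) simp
  have "k * card ?G \<le> k\<^sup>2 div 4 * card V"
  proof (rule nonsingleton_bound)
    fix A assume A: "A \<in> ?G"
    then have AV: "A \<subseteq> V" "A \<in> H" using H by auto
    show "2 \<le> card A"
    proof (rule ccontr)
      assume "\<not> 2 \<le> card A"
      then have "card A = 0 \<or> card A = 1" by linarith
      then have "A = {} \<or> (\<exists>x. A = {x})" using finA[OF AV(2)] by (auto simp: card_1_singleton_iff)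
      then show False using A AV H(2) by auto
    qed
    have "touching ?G A \<union> (\<lambda>x. {x}) ` A \<subseteq> touching H A"
      using AV H(4) by (auto simp: touching_def)
    then have "card (touching ?G A \<union> (\<lambda>x. {x}) ` A) \<le> card (touching H A)"
      using fin by (intro card_mono) auto
    moreover have "card (touching ?G A \<union> (\<lambda>x. {x}) ` A) = card (touching ?G A) + card A"
      using fin finA[OF AV(2)] AV(1) card_S[of A]
      by (subst card_Un_disjoint) (auto simp: touching_def)
    ultimately show "card A + card (touching ?G A) \<le> k + 1"
      using H_touching AV(2) by (metis add.commute order_trans)
  qed (use V(1) H(1) k in auto)
  moreover have "card H = card ?G + card V"
    using card_Diff_subset[of ?S H] card_mono[of H ?S] H(4) V(1) fin card_S[of V]
    by (auto simp: image_subset_iff)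
  ultimately have "k * card H \<le> (k\<^sup>2 div 4 + k) * card V"
    by (simp add: algebra_simps)
  moreover have "k * card F \<le> k * card H" using H(3) by simp
  ultimately show ?thesis by linarith
qed

theorem theorem1p4:
  fixes n k :: nat
  assumes "n \<ge> 1" and "k \<ge> 1"
  shows "real (max_almost_fisher n k 0)
           \<le> real n / real k * real_of_int \<lfloor>(real k)\<^sup>2 / 4\<rfloor> + real n + 1"
proof -
  have "max_almost_fisher n k 0 \<in> {card \<F> |\<F>. \<F> \<subseteq> Pow {1..n} \<and> almost_fisher k 0 \<F>}"
    unfolding max_almost_fisher_def
    by (intro Max_in finite_card_almost_fisher card_almost_fisher_nonempty)
  then obtain F where F: "max_almost_fisher n k 0 = card F" "F \<subseteq> Pow {1..n}" "almost_fisher k 0 F"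
    by auto
  have fin: "finite F" using F(2) by (meson finite_Pow_iff finite_atLeastAtMost finite_subset)
  have "card (touching (F - {{}}) A) \<le> k + 1" if A: "A \<in> F - {{}}" for A
  proof -
    let ?M = "{B \<in> F - {A}. card (A \<inter> B) \<noteq> 0}"
    have "finite A" using A F(2) by (meson DiffD1 PowD finite_atLeastAtMost finite_subset subsetD)
    then have "touching (F - {{}}) A \<subseteq> insert A ?M" by (auto simp: touching_def)
    then have "card (touching (F - {{}}) A) \<le> card (insert A ?M)"
      using fin by (intro card_mono) auto
    also have "\<dots> \<le> Suc (card ?M)" using fin by (simp add: card_insert_if)
    also have "card ?M \<le> k" using F(3) A by (auto simp: almost_fisher_def)
    finally show ?thesis by simp
  qed
  then have "k * card (F - {{}}) \<le> (k\<^sup>2 div 4 + k) * card {1..n}"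
    using F(2) assms by (intro nonempty_family_bound) auto
  then have "real (k * card (F - {{}})) \<le> real ((k\<^sup>2 div 4 + k) * n)"
    unfolding of_nat_le_iff by simp
  then have "real (card (F - {{}})) \<le> real n / real k * real (k\<^sup>2 div 4) + real n"
    using assms(2) by (simp add: field_simps)
  moreover have "card F \<le> card (F - {{}}) + 1"
    using diff_card_le_card_Diff[of "{{}}" F] by simp
  moreover have "\<lfloor>(real k)\<^sup>2 / 4\<rfloor> = int (k\<^sup>2 div 4)"
    using floor_divide_of_nat_eq[of "k\<^sup>2" 4, where 'a=real] by simp
  ultimately show ?thesis unfolding F(1) by simp
qed

end
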